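(* Let $\Gamma$ be a connected finite simple graph on $N\ge3$ vertices whose minimum vertex degree $d$ satisfies $d\ge2$. Then $\varepsilon\le\frac{\sqrt{d-1}}{d}$.
   Context: For a finite simple graph $\Gamma=(V,E)$ without isolated vertices, $\deg v$ is the number of neighbours of $v$ and $\mathcal N(v)=\{w\in V: w\sim v\}$. The normalized Laplacian acts on functions $f:V\to\mathbb R$ by $\Delta f(v)=f(v)-\frac{1}{\deg v}\sum_{w\sim v}f(w)$; its eigenvalues are $0=\lambda_1\le\lambda_2\le\dots\le\lambda_N$, and $\varepsilon:=\min_i|1-\lambda_i|$. $d$ denotes the minimum vertex degree. *)

theory Defs
  imports Complex_Main
begin

definition simple_graph :: "'a set \<Rightarrow> ('a \<Rightarrow> 'a \<Rightarrow> bool) \<Rightarrow> bool" where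
  "simple_graph V E \<longleftrightarrow> finite V \<and> (\<forall>x y. E x y \<longrightarrow> x \<in> V \<and> y \<in> V)
     \<and> (\<forall>x y. E x y \<longrightarrow> E y x) \<and> (\<forall>x. \<not> E x x)"

definition connected_graph :: "'a set \<Rightarrow> ('a \<Rightarrow> 'a \<Rightarrow> bool) \<Rightarrow> bool" where
  "connected_graph V E \<longleftrightarrow> (\<forall>x\<in>V. \<forall>y\<in>V. E\<^sup>*\<^sup>* x y)"

definition neighbours :: "'a set \<Rightarrow> ('a \<Rightarrow> 'a \<Rightarrow> bool) \<Rightarrow> 'a \<Rightarrow> 'a set" where
  "neighbours V E v = {w \<in> V. E v w}"

definition deg :: "'a set \<Rightarrow> ('a \<Rightarrow> 'a \<Rightarrow> bool) \<Rightarrow> 'a \<Rightarrow> nat" where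
  "deg V E v = card (neighbours V E v)"

definition min_degree :: "'a set \<Rightarrow> ('a \<Rightarrow> 'a \<Rightarrow> bool) \<Rightarrow> nat" where
  "min_degree V E = Min (deg V E ` V)"

definition norm_laplacian :: "'a set \<Rightarrow> ('a \<Rightarrow> 'a \<Rightarrow> bool) \<Rightarrow> ('a \<Rightarrow> real) \<Rightarrow> 'a \<Rightarrow> real" where
  "norm_laplacian V E f v = f v - (\<Sum>w\<in>neighbours V E v. f w) / real (deg V E v)"

text \<open>Eigenvalues of the normalized Laplacian (as an operator on real functions on V;
  it is self-adjoint w.r.t. the degree-weighted inner product, so all its eigenvalues are real).\<close>
definition is_laplacian_eigenvalue :: "'a set \<Rightarrow> ('a \<Rightarrow> 'a \<Rightarrow> bool) \<Rightarrow> real \<Rightarrow> bool" where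
  "is_laplacian_eigenvalue V E mu \<longleftrightarrow>
     (\<exists>f :: 'a \<Rightarrow> real. (\<exists>v\<in>V. f v \<noteq> 0) \<and> (\<forall>v\<in>V. norm_laplacian V E f v = mu * f v))"

definition spectral_eps :: "'a set \<Rightarrow> ('a \<Rightarrow> 'a \<Rightarrow> bool) \<Rightarrow> real" where
  "spectral_eps V E = Min {\<bar>1 - mu\<bar> | mu. is_laplacian_eigenvalue V E mu}"

end

theory Submission
  imports Defs "HOL-Analysis.Function_Topology"
begin

text \<open>
  With \<open>P f v = (\<Sum>w\<sim>v. f w) / deg v\<close>, the square of \<open>\<epsilon>\<close> is the minimum of the Rayleigh quotient
  \<open>\<langle>P f, P f\<rangle> / \<langle>f, f\<rangle>\<close> in the degree-weighted inner product. Suppose that it exceeds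
  \<open>q = (d - 1) / d\<^sup>2\<close>. Testing with functions supported on one vertex and on two vertices with a
  common neighbour \<open>w\<close> shows that the excesses \<open>z u = (\<Sum>w\<sim>u. 1 / deg w) - q * deg u\<close> are positive
  and that \<open>z u * z v > 1 / (deg w)\<^sup>2\<close> for distinct neighbours \<open>u\<close>, \<open>v\<close> of \<open>w\<close>. Hence each \<open>w\<close> has
  at most one neighbour \<open>u\<close> with \<open>z u \<le> 1 / deg w\<close>. Vertices of degree \<open>d\<close> have this property with
  respect to all their neighbours, so no vertex has two neighbours of degree \<open>d\<close>; using this,
  the same follows for all degrees up to \<open>d\<^sup>2 - d\<close>. For \<open>d \<ge> 3\<close> a vertex of degree \<open>d\<close> then has
  non-positive excess. For \<open>d = 2\<close> the product inequality fails for the two neighbours of some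
  vertex of degree \<open>2\<close>.
\<close>

section \<open>The Rayleigh quotient of the squared walk operator\<close>

text \<open>Tychonoff's theorem, moved to the topology of the function type.\<close>

lemma compact_PiE_UNIV:
  fixes S :: "'i \<Rightarrow> 'b::topological_space set"
  assumes "\<And>i. compact (S i)"
  shows "compact (PiE UNIV S)"
proof -
  have "compactin (product_topology (\<lambda>i. euclidean) UNIV) (PiE UNIV S)"
    using assms by (simp add: compactin_PiE)
  then show ?thesis
    by (simp add: euclidean_product_topology)
qed

lemma linear_term_zero:
  fixes L Q :: real
  assumes nonneg: "\<And>t. 0 \<le> 2 * t * L + t\<^sup>2 * Q"
  shows "L = 0"
proof (rule ccontr)
  assume L: "L \<noteq> 0"
  \<comment> \<open>For \<open>t = - L / s\<close> with \<open>s > Q\<close> the linear term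
    outweighs the quadratic one; the summand 1 keeps \<open>s\<close> positive when
    \<open>Q = 0\<close>.\<close>
  define s where "s = \<bar>Q\<bar> + 1"
  have s: "s > 0" "Q < s" by (auto simp: s_def)
  have "0 \<le> 2 * (- L / s) * L + (- L / s)\<^sup>2 * Q"
    by (rule nonneg)
  also have "\<dots> = (L\<^sup>2 / s) * (Q / s - 2)"
    using s(1) by (simp add: field_simps power2_eq_square)
  finally have "0 \<le> (L\<^sup>2 / s) * (Q / s - 2)" .
  moreover have "L\<^sup>2 / s > 0" using L s(1) by simp
  moreover have "Q / s - 2 < 0" using s by (simp add: field_simps)
  ultimately show False by (meson mult_pos_neg not_less)
qed

section \<open>The walk operator and its quadratic forms\<close>

locale positive_degree_graph =
  fixes V :: "'a set" and E :: "'a \<Rightarrow> 'a \<Rightarrow> bool"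
  assumes graph: "simple_graph V E"
    and deg_pos: "\<And>v. v \<in> V \<Longrightarrow> 0 < deg V E v"
begin

abbreviation nbrs :: "'a \<Rightarrow> 'a set" where "nbrs \<equiv> neighbours V E"
abbreviation rdeg :: "'a \<Rightarrow> real" where "rdeg v \<equiv> real (deg V E v)"

definition adj :: "('a \<Rightarrow> real) \<Rightarrow> 'a \<Rightarrow> real" where
  "adj f v = (\<Sum>w\<in>nbrs v. f w)"

definition inner_deg :: "('a \<Rightarrow> real) \<Rightarrow> ('a \<Rightarrow> real) \<Rightarrow> real" where
  "inner_deg f g = (\<Sum>v\<in>V. rdeg v * f v * g v)"

text \<open>This is \<open>inner_deg (P f) (P g)\<close> for the walk operator
  \<open>P f v = adj f v / rdeg v\<close>, with one factor \<open>rdeg v\<close> cancelled.\<close>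

definition energy :: "('a \<Rightarrow> real) \<Rightarrow> ('a \<Rightarrow> real) \<Rightarrow> real" where
  "energy f g = (\<Sum>v\<in>V. adj f v * adj g v / rdeg v)"

lemma finite_V: "finite V"
  and edge_in: "E x y \<Longrightarrow> x \<in> V" "E x y \<Longrightarrow> y \<in> V"
  and edge_sym: "E x y \<Longrightarrow> E y x"
  using graph unfolding simple_graph_def by blast+

lemma edge_commute: "E x y \<longleftrightarrow> E y x"
  using edge_sym by blast

lemma finite_nbrs: "finite (nbrs v)"
  using finite_V by (auto simp: neighbours_def)

lemma mem_nbrs: "w \<in> nbrs v \<longleftrightarrow> E v w"
  using edge_in by (auto simp: neighbours_def)

lemma rdeg_pos: "v \<in> V \<Longrightarrow> 0 < rdeg v"
  using deg_pos by simp

lemma adj_alt: "adj f v = (\<Sum>w\<in>V. of_bool (E v w) * f w)"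
  unfolding adj_def neighbours_def using finite_V
  by (intro sum.mono_neutral_cong_left) auto

lemma adj_cong: "(\<And>w. w \<in> V \<Longrightarrow> f w = g w) \<Longrightarrow> adj f v = adj g v"
  by (simp add: adj_alt)

lemma adj_add: "adj (\<lambda>w. f w + g w) v = adj f v + adj g v"
  by (simp add: adj_def sum.distrib)

lemma adj_scale: "adj (\<lambda>w. c * f w) v = c * adj f v"
  by (simp add: adj_def sum_distrib_left)

lemma adj_delta: "u \<in> V \<Longrightarrow> adj (\<lambda>w. of_bool (w = u)) v = of_bool (E v u)"
  using finite_V by (simp add: adj_alt)

lemma adj_self_adjoint: "(\<Sum>v\<in>V. adj f v * g v) = (\<Sum>v\<in>V. f v * adj g v)"
proof -
  have "(\<Sum>v\<in>V. adj f v * g v) = (\<Sum>v\<in>V. \<Sum>w\<in>V. of_bool (E v w) * f w * g v)"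
    by (simp add: adj_alt sum_distrib_right)
  also have "\<dots> = (\<Sum>w\<in>V. \<Sum>v\<in>V. of_bool (E v w) * f w * g v)"
    by (rule sum.swap)
  also have "\<dots> = (\<Sum>v\<in>V. f v * adj g v)"
    by (simp add: adj_alt sum_distrib_left edge_commute mult_ac)
  finally show ?thesis .
qed

lemma eigenvalue_iff:
  "is_laplacian_eigenvalue V E mu \<longleftrightarrow>
    (\<exists>f. (\<exists>v\<in>V. f v \<noteq> 0) \<and> (\<forall>v\<in>V. adj f v = (1 - mu) * rdeg v * f v))"
proof -
  have "norm_laplacian V E f v = mu * f v \<longleftrightarrow> adj f v = (1 - mu) * rdeg v * f v"
    if "v \<in> V" for f v
    using rdeg_pos[OF that] unfolding norm_laplacian_def adj_def[symmetric]
    by (auto simp: field_simps)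
  then show ?thesis
    unfolding is_laplacian_eigenvalue_def by (metis (no_types, lifting))
qed

lemma inner_deg_commute: "inner_deg f g = inner_deg g f"
  by (simp add: inner_deg_def mult_ac)

lemma inner_deg_nonneg: "0 \<le> inner_deg f f"
  unfolding inner_deg_def by (auto intro!: sum_nonneg simp: mult.assoc)

lemma inner_deg_eq_0_iff: "inner_deg f f = 0 \<longleftrightarrow> (\<forall>v\<in>V. f v = 0)"
proof -
  have "inner_deg f f = 0 \<longleftrightarrow> (\<forall>v\<in>V. rdeg v * f v * f v = 0)"
    unfolding inner_deg_def using finite_V
    by (intro sum_nonneg_eq_0_iff) (auto simp: mult.assoc)
  also have "\<dots> \<longleftrightarrow> (\<forall>v\<in>V. f v = 0)"
    using deg_pos by fastforce
  finally show ?thesis .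
qed

lemma square_le_inner_deg:
  assumes "v \<in> V"
  shows "(f v)\<^sup>2 \<le> inner_deg f f"
proof -
  have "1 * (f v)\<^sup>2 \<le> rdeg v * (f v)\<^sup>2"
    using deg_pos[OF assms] by (intro mult_right_mono) auto
  also have "\<dots> \<le> (\<Sum>v\<in>V. rdeg v * (f v)\<^sup>2)"
    using finite_V assms by (intro member_le_sum) auto
  finally show ?thesis
    by (simp add: inner_deg_def power2_eq_square mult.assoc)
qed

lemma inner_deg_pos: "v \<in> V \<Longrightarrow> f v \<noteq> 0 \<Longrightarrow> 0 < inner_deg f f"
  using inner_deg_eq_0_iff[of f] inner_deg_nonneg[of f] by fastforce

lemma inner_deg_delta: "v \<in> V \<Longrightarrow> inner_deg f (\<lambda>w. of_bool (w = v)) = rdeg v * f v"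
  using finite_V by (simp add: inner_deg_def)

lemma inner_deg_scale: "inner_deg (\<lambda>v. c * f v) (\<lambda>v. c * f v) = c\<^sup>2 * inner_deg f f"
  by (simp add: inner_deg_def sum_distrib_left power2_eq_square mult_ac)

lemma inner_deg_add_scaled:
  "inner_deg (\<lambda>v. g v + t * h v) (\<lambda>v. g v + t * h v)
    = inner_deg g g + 2 * t * inner_deg g h + t\<^sup>2 * inner_deg h h"
  by (simp add: inner_deg_def sum_distrib_left sum.distrib[symmetric] power2_eq_square algebra_simps)

lemma energy_nonneg: "0 \<le> energy f f"
  unfolding energy_def by (auto intro!: sum_nonneg)

lemma energy_scale: "energy (\<lambda>v. c * f v) (\<lambda>v. c * f v) = c\<^sup>2 * energy f f"
  by (simp add: energy_def adj_scale sum_distrib_left power2_eq_square mult_ac)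

lemma energy_add_scaled:
  "energy (\<lambda>v. g v + t * h v) (\<lambda>v. g v + t * h v)
    = energy g g + 2 * t * energy g h + t\<^sup>2 * energy h h"
  by (simp add: energy_def adj_add adj_scale sum_distrib_left sum.distrib[symmetric]
      power2_eq_square algebra_simps add_divide_distrib)

text \<open>\<open>P\<close> is self-adjoint, so pairing \<open>P g\<close> with the image of an
  indicator evaluates \<open>P (P g)\<close> at \<open>v\<close>, up to the weight
  \<open>rdeg v\<close>.\<close>

lemma energy_delta:
  assumes "v \<in> V"
  shows "energy g (\<lambda>w. of_bool (w = v)) = adj (\<lambda>w. adj g w / rdeg w) v"
  using assms by (simp add: energy_def adj_delta adj_alt[of _ v] edge_commute mult_ac)

section \<open>Finiteness of the spectrum\<close>

lemma eigenfunctions_orthogonal: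
  assumes "\<forall>v\<in>V. adj f v = \<kappa> * rdeg v * f v" "\<forall>v\<in>V. adj g v = \<mu> * rdeg v * g v" "\<kappa> \<noteq> \<mu>"
  shows "inner_deg f g = 0"
proof -
  have "\<kappa> * inner_deg f g = (\<Sum>v\<in>V. adj f v * g v)"
    using assms(1) by (simp add: inner_deg_def sum_distrib_left mult_ac)
  also have "\<dots> = (\<Sum>v\<in>V. f v * adj g v)"
    by (rule adj_self_adjoint)
  also have "\<dots> = \<mu> * inner_deg f g"
    using assms(2) by (simp add: inner_deg_def sum_distrib_left mult_ac)
  finally show ?thesis using assms(3) by simp
qed

text \<open>Bessel's inequality applied to the indicator function of a vertex \<open>v\<close>, divided by
  \<^term>\<open>rdeg v\<close>; summing it over \<open>v\<close> bounds the size of an orthonormal system.\<close>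

lemma bessel_delta:
  assumes "finite I" "v \<in> V"
    and orth: "\<And>i j. i \<in> I \<Longrightarrow> j \<in> I \<Longrightarrow> inner_deg (f i) (f j) = of_bool (i = j)"
  shows "(\<Sum>i\<in>I. rdeg v * f i v * f i v) \<le> 1"
proof -
  \<comment> \<open>The orthogonal projection of the indicator onto the span of the system: its
    coefficients are the inner products \<open>rdeg v * f i v\<close>.\<close>
  define p where "p = (\<lambda>w. \<Sum>i\<in>I. rdeg v * f i v * f i w)"
  define \<delta> where "\<delta> = (\<lambda>w. of_bool (w = v) :: real)"
  have pp: "inner_deg p p = (\<Sum>i\<in>I. (rdeg v * f i v)\<^sup>2)"
  proof -
    have "inner_deg p p =
      (\<Sum>w\<in>V. \<Sum>i\<in>I. \<Sum>j\<in>I. (rdeg v * f i v) * (rdeg v * f j v) * (rdeg w * f i w * f j w))"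
      unfolding inner_deg_def p_def
      by (intro sum.cong refl) (simp add: sum_distrib_left sum_distrib_right mult_ac)
    also have "\<dots> =
      (\<Sum>i\<in>I. \<Sum>j\<in>I. (rdeg v * f i v) * (rdeg v * f j v) * inner_deg (f i) (f j))"
      unfolding inner_deg_def sum_distrib_left
      by (subst sum.swap, intro sum.cong refl, rule sum.swap)
    also have "\<dots> = (\<Sum>i\<in>I. \<Sum>j\<in>I. (rdeg v * f i v) * (rdeg v * f j v) * of_bool (i = j))"
      using orth by (intro sum.cong refl) simp
    also have "\<dots> = (\<Sum>i\<in>I. (rdeg v * f i v)\<^sup>2)"
      using assms(1) by (simp add: power2_eq_square)
    finally show ?thesis .
  qed
  have pd: "inner_deg p \<delta> = (\<Sum>i\<in>I. (rdeg v * f i v)\<^sup>2)"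
    using assms(2) unfolding \<delta>_def
    by (simp add: inner_deg_delta p_def sum_distrib_left power2_eq_square mult_ac)
  have dd: "inner_deg \<delta> \<delta> = rdeg v"
    using assms(2) unfolding \<delta>_def by (simp add: inner_deg_delta)
  have "0 \<le> inner_deg (\<lambda>w. \<delta> w + (-1) * p w) (\<lambda>w. \<delta> w + (-1) * p w)"
    by (rule inner_deg_nonneg)
  also have "\<dots> = rdeg v - (\<Sum>i\<in>I. (rdeg v * f i v)\<^sup>2)"
    unfolding inner_deg_add_scaled by (simp add: pp pd dd inner_deg_commute[of \<delta> p])
  also have "\<dots> = rdeg v * (1 - (\<Sum>i\<in>I. rdeg v * f i v * f i v))"
    by (simp add: algebra_simps sum_distrib_left power2_eq_square)
  finally show ?thesis
    using rdeg_pos[OF assms(2)] by (simp add: zero_le_mult_iff)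
qed

text \<open>Normalised eigenfunctions for distinct eigenvalues are orthonormal. Their squared norms
  add up to \<open>card I\<close>, and by \<open>bessel_delta\<close> each vertex contributes at
  most 1 to this total.\<close>

lemma card_eigenvalues_le:
  assumes "finite I" "\<forall>mu\<in>I. is_laplacian_eigenvalue V E mu"
  shows "card I \<le> card V"
proof -
  have "\<exists>f. inner_deg f f = 1 \<and> (\<forall>v\<in>V. adj f v = (1 - mu) * rdeg v * f v)"
    if mu: "mu \<in> I" for mu
  proof -
    obtain f v where f: "v \<in> V" "f v \<noteq> 0" "\<forall>v\<in>V. adj f v = (1 - mu) * rdeg v * f v"
      using bspec[OF assms(2) mu] unfolding eigenvalue_iff by blast
    define c where "c = 1 / sqrt (inner_deg f f)"
    have "c\<^sup>2 * inner_deg f f = 1"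
      using inner_deg_pos[of v f] f by (simp add: c_def power_divide)
    then have "inner_deg (\<lambda>v. c * f v) (\<lambda>v. c * f v) = 1"
      by (simp add: inner_deg_scale)
    moreover have "\<forall>v\<in>V. adj (\<lambda>v. c * f v) v = (1 - mu) * rdeg v * (c * f v)"
      using f(3) by (simp add: adj_scale)
    ultimately show ?thesis by blast
  qed
  then have "\<exists>f. \<forall>mu\<in>I. inner_deg (f mu) (f mu) = 1 \<and>
      (\<forall>v\<in>V. adj (f mu) v = (1 - mu) * rdeg v * f mu v)"
    by (intro bchoice) blast
  then obtain f where f: "\<And>mu. mu \<in> I \<Longrightarrow> inner_deg (f mu) (f mu) = 1"
    "\<And>mu. mu \<in> I \<Longrightarrow> \<forall>v\<in>V. adj (f mu) v = (1 - mu) * rdeg v * f mu v"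
    by blast
  have orth: "inner_deg (f i) (f j) = of_bool (i = j)" if "i \<in> I" "j \<in> I" for i j
  proof (cases "i = j")
    case True
    then show ?thesis using f(1)[OF that(1)] by simp
  next
    case False
    then have "1 - i \<noteq> 1 - j" by simp
    from eigenfunctions_orthogonal[OF f(2)[OF that(1)] f(2)[OF that(2)] this] False
    show ?thesis by simp
  qed
  have "real (card I) = (\<Sum>i\<in>I. inner_deg (f i) (f i))"
    using f(1) by simp
  also have "\<dots> = (\<Sum>v\<in>V. \<Sum>i\<in>I. rdeg v * f i v * f i v)"
    unfolding inner_deg_def by (rule sum.swap)
  also have "\<dots> \<le> (\<Sum>v\<in>V. 1)"
    by (intro sum_mono bessel_delta assms orth)
  finally show ?thesis by simp
qed

text \<open>Needed because the \<open>Min\<close> in \<open>spectral_eps\<close> is a lower bound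
  only over a finite set.\<close>

lemma finite_eigenvalues: "finite {mu. is_laplacian_eigenvalue V E mu}"
proof (rule ccontr)
  assume "infinite {mu. is_laplacian_eigenvalue V E mu}"
  then obtain I where "I \<subseteq> {mu. is_laplacian_eigenvalue V E mu}" "finite I"
    "card I = Suc (card V)"
    using infinite_arbitrarily_large by blast
  then show False using card_eigenvalues_le[of I] by auto
qed

lemma spectral_eps_le:
  assumes "is_laplacian_eigenvalue V E mu"
  shows "spectral_eps V E \<le> \<bar>1 - mu\<bar>"
  unfolding spectral_eps_def
proof (rule Min_le)
  have "{\<bar>1 - mu\<bar> | mu. is_laplacian_eigenvalue V E mu}
      = (\<lambda>mu. \<bar>1 - mu\<bar>) ` {mu. is_laplacian_eigenvalue V E mu}"
    by auto
  then show "finite {\<bar>1 - mu\<bar> | mu. is_laplacian_eigenvalue V E mu}"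
    using finite_eigenvalues by simp
qed (use assms in auto)

section \<open>Minimising the Rayleigh quotient\<close>

lemma ex_energy_minimizer:
  assumes "V \<noteq> {}"
  obtains g where "inner_deg g g = 1" "\<And>f. energy g g * inner_deg f f \<le> energy f f"
proof -
  define B where "B = (\<lambda>v. if v \<in> V then {-1..1::real} else {0})"
  \<comment> \<open>The unit sphere made compact: values outside \<open>V\<close> are frozen at 0,
    and the box loses nothing on \<open>V\<close> by \<open>square_le_inner_deg\<close>.\<close>
  define C where "C = PiE UNIV B \<inter> {f. inner_deg f f = 1}"
  have coord: "continuous_on S (\<lambda>f::'a \<Rightarrow> real. f v)" for S v
    by (rule continuous_on_subset[OF continuous_on_product_coordinates]) simp
  have cont_inner: "continuous_on S (\<lambda>f. inner_deg f f)" for S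
    unfolding inner_deg_def by (intro continuous_intros coord)
  have cont_energy: "continuous_on S (\<lambda>f. energy f f)" for S
    unfolding energy_def adj_def by (intro continuous_intros coord) (use rdeg_pos in force)
  have "closed {f. inner_deg f f = 1}"
    using closed_Collect_eq[OF cont_inner, of "\<lambda>_. 1"] by simp
  moreover have "compact (PiE UNIV B)"
    by (rule compact_PiE_UNIV) (simp add: B_def)
  ultimately have "compact C"
    unfolding C_def by (rule compact_Int_closed[rotated])
  have in_C: "(\<lambda>v. if v \<in> V then f v / sqrt (inner_deg f f) else 0) \<in> C" (is "?g \<in> C")
    if "inner_deg f f \<noteq> 0" for f
  proof -
    have pos: "inner_deg f f > 0"
      using that inner_deg_nonneg[of f] by simp
    have "inner_deg ?g ?g
        = inner_deg (\<lambda>v. (1 / sqrt (inner_deg f f)) * f v) (\<lambda>v. (1 / sqrt (inner_deg f f)) * f v)"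
      by (auto simp: inner_deg_def intro!: sum.cong)
    also have "\<dots> = 1"
      using pos unfolding inner_deg_scale by (simp add: power_divide)
    finally have one: "inner_deg ?g ?g = 1" .
    have "- ?g v \<le> 1 \<and> ?g v \<le> 1" if "v \<in> V" for v
      using square_le_inner_deg[OF that, of ?g] one by (simp only: abs_square_le_1 abs_le_iff)
    then have "?g v \<in> B v" for v
      by (cases "v \<in> V") (auto simp: B_def minus_le_iff)
    then show ?thesis
      unfolding C_def using one by blast
  qed
  obtain v where v: "v \<in> V" using assms by blast
  have "C \<noteq> {}"
    using in_C[of "\<lambda>_. 1"] inner_deg_pos[OF v, of "\<lambda>_. 1"] by fastforce
  with \<open>compact C\<close> obtain g where g: "g \<in> C" "\<And>f. f \<in> C \<Longrightarrow> energy g g \<le> energy f f"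
    using continuous_attains_inf[of C "\<lambda>f. energy f f"] cont_energy by blast
  have "energy g g * inner_deg f f \<le> energy f f" for f
  proof (cases "inner_deg f f = 0")
    case True
    then show ?thesis using energy_nonneg by simp
  next
    case False
    then have pos: "inner_deg f f > 0"
      using inner_deg_nonneg[of f] by simp
    let ?g = "\<lambda>v. if v \<in> V then f v / sqrt (inner_deg f f) else 0"
    have "adj ?g = adj (\<lambda>v. (1 / sqrt (inner_deg f f)) * f v)"
      by (intro ext adj_cong) simp
    then have "energy ?g ?g
        = energy (\<lambda>v. (1 / sqrt (inner_deg f f)) * f v) (\<lambda>v. (1 / sqrt (inner_deg f f)) * f v)"
      by (simp add: energy_def)
    also have "\<dots> = energy f f / inner_deg f f"
      using pos unfolding energy_scale by (simp add: power_divide)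
    finally have "energy ?g ?g = energy f f / inner_deg f f" .
    then show ?thesis
      using g(2)[OF in_C[OF False]] pos by (simp add: pos_le_divide_eq)
  qed
  moreover have "inner_deg g g = 1"
    using g(1) by (simp add: C_def)
  ultimately show thesis by (rule that[rotated])
qed

text \<open>The minimum \<open>m\<close> is an eigenvalue of the squared walk operator, so
  \<open>sqrt m\<close> or \<open>- sqrt m\<close> is one of the walk operator itself.\<close>

lemma spectral_eps_rayleigh:
  assumes "V \<noteq> {}"
  obtains m where "0 \<le> m" "spectral_eps V E \<le> sqrt m" "\<And>f. m * inner_deg f f \<le> energy f f"
proof -
  obtain g where g: "inner_deg g g = 1" "\<And>f. energy g g * inner_deg f f \<le> energy f f"
    using ex_energy_minimizer[OF assms] by blast
  define m where "m = energy g g"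
  define \<kappa> where "\<kappa> = sqrt m"
  have m: "0 \<le> m" by (simp add: m_def energy_nonneg)
  then have \<kappa>: "0 \<le> \<kappa>" "\<kappa> * \<kappa> = m" by (simp_all add: \<kappa>_def)
  define p where "p = (\<lambda>w. adj g w / rdeg w)"
  have p: "adj g v = rdeg v * p v" if "v \<in> V" for v
    using rdeg_pos[OF that] by (simp add: p_def)
  \<comment> \<open>The Euler--Lagrange equation of the minimisation: \<open>g\<close> is an eigenfunction of the squared walk operator.\<close>
  have adj_p: "adj p v = m * rdeg v * g v" if v: "v \<in> V" for v
  proof -
    define h where "h = (\<lambda>w. of_bool (w = v) :: real)"
    have "0 \<le> 2 * t * (energy g h - m * inner_deg g h) + t\<^sup>2 * (energy h h - m * inner_deg h h)" for t
      using g(2)[of "\<lambda>w. g w + t * h w"] g(1)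
      unfolding inner_deg_add_scaled energy_add_scaled m_def[symmetric]
      by (simp add: algebra_simps)
    then have "energy g h - m * inner_deg g h = 0"
      by (rule linear_term_zero)
    then show ?thesis
      using v by (simp add: h_def energy_delta inner_deg_delta p_def mult_ac)
  qed
  \<comment> \<open>Factor \<open>P * P - m\<close> as
    \<open>(P - \<kappa>) * (P + \<kappa>)\<close>: either \<open>h = (P + \<kappa>) g\<close> is an
    eigenfunction for \<open>\<kappa>\<close>, or it vanishes on \<open>V\<close> and
    \<open>g\<close> is one for \<open>- \<kappa>\<close>.\<close>
  define h where "h = (\<lambda>v. p v + \<kappa> * g v)"
  have adj_h: "adj h v = \<kappa> * rdeg v * h v" if "v \<in> V" for v
    using that \<kappa>(2)[symmetric] by (simp add: h_def adj_add adj_scale adj_p p algebra_simps)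
  have "\<exists>mu. is_laplacian_eigenvalue V E mu \<and> \<bar>1 - mu\<bar> = \<kappa>"
  proof (cases "\<exists>v\<in>V. h v \<noteq> 0")
    case True
    then have "is_laplacian_eigenvalue V E (1 - \<kappa>)"
      unfolding eigenvalue_iff using adj_h by (intro exI[of _ h]) simp
    then show ?thesis using \<kappa>(1) by (intro exI[of _ "1 - \<kappa>"]) simp
  next
    case False
    have "\<exists>v\<in>V. g v \<noteq> 0"
      using g(1) inner_deg_eq_0_iff[of g] by auto
    moreover have "adj g v = - \<kappa> * rdeg v * g v" if "v \<in> V" for v
    proof -
      have "p v = - \<kappa> * g v" using False that by (auto simp: h_def eq_neg_iff_add_eq_0)
      then show ?thesis using p[OF that] by simp
    qed
    ultimately have "is_laplacian_eigenvalue V E (1 + \<kappa>)"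
      unfolding eigenvalue_iff by (intro exI[of _ g]) simp
    then show ?thesis using \<kappa>(1) by (intro exI[of _ "1 + \<kappa>"]) simp
  qed
  then have "spectral_eps V E \<le> sqrt m"
    using spectral_eps_le \<kappa>_def by metis
  then show thesis
    using that m g(2) unfolding m_def by blast
qed

end

section \<open>Test functions supported on two vertices\<close>

text \<open>The inequality \<open>coercive\<close> says that all eigenvalues \<open>\<kappa>\<close> of the random walk satisfy \<open>\<kappa>\<^sup>2 > q\<close>.\<close>

locale spectral_gap_graph = positive_degree_graph +
  fixes q :: real
  assumes coercive: "\<And>f. \<exists>v\<in>V. f v \<noteq> 0 \<Longrightarrow> q * inner_deg f f < energy f f"
begin

text \<open>The value of the form \<open>energy - q * inner_deg\<close> on the indicator of
  \<open>u\<close>.\<close>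

definition excess :: "'a \<Rightarrow> real" where
  "excess u = (\<Sum>w\<in>nbrs u. 1 / rdeg w) - q * rdeg u"

lemma energy_delta_delta:
  assumes "u \<in> V" "v \<in> V"
  shows "energy (\<lambda>w. of_bool (w = u)) (\<lambda>w. of_bool (w = v)) = (\<Sum>w\<in>nbrs u \<inter> nbrs v. 1 / rdeg w)"
proof -
  have "energy (\<lambda>w. of_bool (w = u)) (\<lambda>w. of_bool (w = v))
      = (\<Sum>w\<in>V. of_bool (E w u) * of_bool (E w v) / rdeg w)"
    using assms by (simp add: energy_def adj_delta)
  also have "\<dots> = (\<Sum>w\<in>nbrs u \<inter> nbrs v. 1 / rdeg w)"
    using finite_V
    by (intro sum.mono_neutral_cong_right) (auto simp: neighbours_def edge_commute)
  finally show ?thesis .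
qed

lemma excess_quadratic_pos:
  assumes "u \<in> V" "v \<in> V" "u \<noteq> v"
  shows "0 < excess u + 2 * t * (\<Sum>w\<in>nbrs u \<inter> nbrs v. 1 / rdeg w) + t\<^sup>2 * excess v"
proof -
  let ?\<delta> = "\<lambda>u w. of_bool (w = u) :: real"
  let ?f = "\<lambda>w. ?\<delta> u w + t * ?\<delta> v w"
  have "q * inner_deg ?f ?f < energy ?f ?f"
    using assms by (intro coercive bexI[of _ u]) auto
  then show ?thesis
    using assms unfolding inner_deg_add_scaled energy_add_scaled
    by (simp add: energy_delta_delta inner_deg_delta excess_def algebra_simps)
qed

lemma excess_pos:
  assumes "u \<in> V"
  shows "0 < excess u"
proof -
  let ?\<delta> = "\<lambda>w. of_bool (w = u) :: real"
  have "q * inner_deg ?\<delta> ?\<delta> < energy ?\<delta> ?\<delta>"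
    using assms by (intro coercive bexI[of _ u]) auto
  then show ?thesis
    using assms by (simp add: energy_delta_delta inner_deg_delta excess_def)
qed

text \<open>A quadratic in \<open>t\<close> that is positive everywhere has negative discriminant;
  its mixed coefficient is at least \<open>1 / rdeg w\<close>, as \<open>w\<close> is a common
  neighbour.\<close>

lemma excess_mult_gt:
  assumes "E w u" "E w v" "u \<noteq> v"
  shows "(1 / rdeg w)\<^sup>2 < excess u * excess v"
proof -
  define c where "c = (\<Sum>w\<in>nbrs u \<inter> nbrs v. 1 / rdeg w)"
  have uv: "u \<in> V" "v \<in> V" using assms edge_in by auto
  have "1 / rdeg w \<le> c"
    unfolding c_def using assms edge_sym finite_nbrs
    by (intro member_le_sum[of w "nbrs u \<inter> nbrs v" "\<lambda>w. 1 / rdeg w"]) (auto simp: mem_nbrs)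
  then have "(1 / rdeg w)\<^sup>2 \<le> c\<^sup>2"
    by (intro power_mono) auto
  also have "c\<^sup>2 < excess u * excess v"
  proof -
    have v: "0 < excess v" by (rule excess_pos[OF uv(2)])
    \<comment> \<open>The quadratic is evaluated at its minimum point.\<close>
    have "0 < excess u + 2 * (- c / excess v) * c + (- c / excess v)\<^sup>2 * excess v"
      using excess_quadratic_pos[OF uv assms(3)] by (simp only: c_def)
    also have "\<dots> = excess u - c\<^sup>2 / excess v"
      using v by (simp add: field_simps power2_eq_square)
    finally show ?thesis using v by (simp add: field_simps)
  qed
  finally show ?thesis .
qed

lemma small_excess_unique:
  assumes "E w u" "E w v" "excess u \<le> 1 / rdeg w" "excess v \<le> 1 / rdeg w"
  shows "u = v"
proof (rule ccontr)
  assume "u \<noteq> v"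
  from excess_mult_gt[OF assms(1,2) this] have "(1 / rdeg w)\<^sup>2 < excess u * excess v" .
  also have "\<dots> \<le> 1 / rdeg w * (1 / rdeg w)"
    using assms excess_pos[of v] edge_in by (intro mult_mono) auto
  finally show False by (simp add: power2_eq_square)
qed

text \<open>Reduces \<open>excess u \<le> 1 / rdeg w\<close> to bounding the sum over the other
  neighbours by \<open>q * rdeg u\<close>.\<close>

lemma excess_split:
  assumes "E u w"
  shows "excess u = 1 / rdeg w + (\<Sum>x\<in>nbrs u - {w}. 1 / rdeg x) - q * rdeg u"
  unfolding excess_def using assms finite_nbrs
  by (subst sum.remove[of _ w]) (auto simp: mem_nbrs)

end

lemma sum_le_one_exception:
  fixes f :: "'b \<Rightarrow> real"
  assumes "finite X" "\<beta> \<le> \<alpha>" "\<And>x. x \<in> X \<Longrightarrow> f x \<le> \<alpha>"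
    and exc: "\<And>x y. x \<in> X \<Longrightarrow> y \<in> X \<Longrightarrow> \<beta> < f x \<Longrightarrow> \<beta> < f y \<Longrightarrow> x = y"
  shows "sum f X \<le> \<alpha> + (real (card X) - 1) * \<beta>"
proof (cases "\<exists>x\<in>X. \<beta> < f x")
  case True
  then obtain x where x: "x \<in> X" "\<beta> < f x" by blast
  have "sum f (X - {x}) \<le> real (card (X - {x})) * \<beta>"
    using exc[OF _ x(1) _ x(2)] by (intro sum_bounded_above) force
  also have "real (card (X - {x})) = real (card X) - 1"
    using x(1) assms(1) by (subst card.remove[of X x]) auto
  finally show ?thesis
    using assms(3)[OF x(1)] by (simp add: sum.remove[OF assms(1) x(1)])
next
  case False
  then have "sum f X \<le> real (card X) * \<beta>"
    by (intro sum_bounded_above) (simp add: not_less)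
  \<comment> \<open>Trading one \<open>\<beta>\<close> for \<open>\<alpha>\<close> also covers empty
    \<open>X\<close>, where the bound is \<open>\<alpha> - \<beta>\<close>.\<close>
  then show ?thesis using assms(2) by (simp add: algebra_simps)
qed

section \<open>Low-degree neighbours\<close>

locale extremal_gap_graph = spectral_gap_graph V E "(real d - 1) / (real d)\<^sup>2"
  for V :: "'a set" and E :: "'a \<Rightarrow> 'a \<Rightarrow> bool" and d :: nat +
  assumes d_ge_2: "2 \<le> d"
    and deg_ge: "\<And>v. v \<in> V \<Longrightarrow> d \<le> deg V E v"
begin

abbreviation "q \<equiv> (real d - 1) / (real d)\<^sup>2"

lemma inverse_deg_le: "v \<in> V \<Longrightarrow> 1 / rdeg v \<le> 1 / real d"
  using deg_ge[of v] d_ge_2 by (intro divide_left_mono) auto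

text \<open>The other \<open>d - 1\<close> neighbours contribute at most \<open>1 / d\<close> each,
  in total \<open>(d - 1) / d\<close>, which is exactly \<open>q * d\<close>.\<close>

lemma excess_min_degree_le:
  assumes "E u w" "deg V E u \<le> d"
  shows "excess u \<le> 1 / rdeg w"
proof -
  have u: "rdeg u = real d" using assms deg_ge[of u] edge_in by fastforce
  have c: "card (nbrs u - {w}) = d - 1"
    using u assms finite_nbrs by (simp add: mem_nbrs deg_def)
  have "(\<Sum>x\<in>nbrs u - {w}. 1 / rdeg x) \<le> real (card (nbrs u - {w})) * (1 / real d)"
    using edge_in by (intro sum_bounded_above inverse_deg_le) (auto simp: mem_nbrs)
  also have "\<dots> = q * rdeg u"
    using d_ge_2 unfolding c u by (simp add: of_nat_diff power2_eq_square)
  finally show ?thesis using excess_split[OF assms(1)] by simp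
qed

lemma min_degree_nbr_unique:
  assumes "E w u" "E w v" "deg V E u \<le> d" "deg V E v \<le> d"
  shows "u = v"
  using assms edge_sym excess_min_degree_le by (intro small_excess_unique) blast+

text \<open>All but at most one vertex of \<open>X\<close> have degree at least
  \<open>K + 1\<close>. The parameter \<open>K\<close> allows a bootstrap: first
  \<open>K = d\<close>, then \<open>K = d\<^sup>2 - d\<close>.\<close>

lemma sum_inverse_deg_le:
  assumes "X \<subseteq> nbrs u"
    and unique: "\<And>x y. E u x \<Longrightarrow> E u y \<Longrightarrow> deg V E x \<le> K \<Longrightarrow> deg V E y \<le> K \<Longrightarrow> x = y"
    and "d \<le> K"
  shows "(\<Sum>x\<in>X. 1 / rdeg x) \<le> 1 / real d + (real (card X) - 1) / (real K + 1)"
proof -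
  have XV: "x \<in> V" "E u x" if "x \<in> X" for x
    using that assms(1) edge_in by (auto simp: mem_nbrs)
  have K: "deg V E x \<le> K" if "x \<in> X" "1 / (real K + 1) < 1 / rdeg x" for x
  proof -
    have "rdeg x < real K + 1"
      using that rdeg_pos[OF XV(1)[OF that(1)]] by (simp add: field_simps)
    then show ?thesis by linarith
  qed
  have "(\<Sum>x\<in>X. 1 / rdeg x) \<le> 1 / real d + (real (card X) - 1) * (1 / (real K + 1))"
  proof (rule sum_le_one_exception)
    show "finite X" using assms(1) finite_nbrs finite_subset by blast
    show "1 / (real K + 1) \<le> 1 / real d" using assms(3) d_ge_2 by (intro divide_left_mono) auto
    show "1 / rdeg x \<le> 1 / real d" if "x \<in> X" for x using XV that inverse_deg_le by blast
    show "x = y"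
      if "x \<in> X" "y \<in> X" "1 / (real K + 1) < 1 / rdeg x" "1 / (real K + 1) < 1 / rdeg y" for x y
      using that K XV by (intro unique) blast+
  qed
  then show ?thesis by simp
qed

text \<open>With \<open>K = d\<close>, the slack left in the bound has the sign of
  \<open>d\<^sup>2 - d - k\<close>, which explains the threshold. For \<open>d = 2\<close> the
  threshold is \<open>d\<close> again and nothing is gained.\<close>

lemma excess_moderate_degree_le:
  assumes "E u w" "deg V E u \<le> d\<^sup>2 - d"
  shows "excess u \<le> 1 / rdeg w"
proof -
  define k where "k = rdeg u"
  have "0 < deg V E u" using deg_pos assms edge_in by blast
  then have c: "real (card (nbrs u - {w})) = k - 1"
    using assms finite_nbrs by (simp add: mem_nbrs deg_def k_def of_nat_diff)
  have "d \<le> d\<^sup>2" by (simp add: power2_eq_square)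
  then have k: "k \<le> (real d)\<^sup>2 - real d"
    unfolding k_def using of_nat_mono[OF assms(2), where ?'a = real] by (simp add: of_nat_diff)
  have d: "0 < real d" using d_ge_2 by simp
  have "(\<Sum>x\<in>nbrs u - {w}. 1 / rdeg x) \<le> 1 / real d + (k - 1 - 1) / (real d + 1)"
    unfolding c[symmetric] using min_degree_nbr_unique
    by (intro sum_inverse_deg_le) auto
  also have "\<dots> \<le> q * k"
  proof -
    have "q * k - (1 / real d + (k - 1 - 1) / (real d + 1))
        = ((real d)\<^sup>2 - real d - k) / ((real d)\<^sup>2 * (real d + 1))"
      using d by (simp add: divide_simps) (simp add: algebra_simps power2_eq_square)
    moreover have "0 \<le> ((real d)\<^sup>2 - real d - k) / ((real d)\<^sup>2 * (real d + 1))"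
      using k by (intro divide_nonneg_nonneg) auto
    ultimately show ?thesis by linarith
  qed
  finally show ?thesis using excess_split[OF assms(1)] by (simp add: k_def)
qed

lemma moderate_degree_nbr_unique:
  assumes "E w u" "E w v" "deg V E u \<le> d\<^sup>2 - d" "deg V E v \<le> d\<^sup>2 - d"
  shows "u = v"
  using assms edge_sym excess_moderate_degree_le by (intro small_excess_unique) blast+

section \<open>Contradiction for minimum degree at least 3\<close>

lemma no_min_degree_vertex_if_ge_3:
  assumes "3 \<le> d" "u \<in> V"
  shows "deg V E u \<noteq> d"
proof
  assume u: "deg V E u = d"
  define D where "D = real d"
  have D: "3 \<le> D" using assms(1) by (simp add: D_def)
  have "2 * d \<le> d\<^sup>2"
    unfolding power2_eq_square by (rule mult_le_mono1[OF d_ge_2])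
  then have le: "d \<le> d\<^sup>2" "d \<le> d\<^sup>2 - d" by linarith+
  have "(\<Sum>x\<in>nbrs u. 1 / rdeg x) \<le> 1 / real d + (rdeg u - 1) / (real (d\<^sup>2 - d) + 1)"
    unfolding deg_def[of V E u] using moderate_degree_nbr_unique le(2)
    by (intro sum_inverse_deg_le) auto
  then have "(\<Sum>x\<in>nbrs u. 1 / rdeg x) \<le> 1 / D + (D - 1) / (D\<^sup>2 - D + 1)"
    using u le(1) by (simp add: D_def of_nat_diff)
  also have "\<dots> \<le> (D - 1) / D"
  proof -
    have "1 * D \<le> D * D" using D by (intro mult_right_mono) auto
    then have pos: "0 < D\<^sup>2 - D + 1" by (simp add: power2_eq_square)
    \<comment> \<open>Here \<open>d \<ge> 3\<close> enters, as \<open>1 \<le> D - 2\<close>.\<close>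
    have "1 * (D\<^sup>2 - D + 1) \<le> (D - 2) * (D\<^sup>2 - D + 1)"
      using D pos by (intro mult_right_mono) auto
    then have "(D - 1) * D \<le> (D - 2) * (D\<^sup>2 - D + 1)"
      by (simp add: algebra_simps power2_eq_square)
    then have "(D - 1) / (D\<^sup>2 - D + 1) \<le> (D - 2) / D"
      using pos D by (simp add: pos_divide_le_eq pos_le_divide_eq mult.commute)
    then show ?thesis using D by (simp add: diff_divide_distrib)
  qed
  also have "\<dots> = q * rdeg u"
    using D u by (simp add: D_def power2_eq_square)
  finally show False using excess_pos[OF assms(2)] by (simp add: excess_def)
qed

section \<open>Contradiction for minimum degree 2\<close>

lemma excess_le_if_eq_2:
  assumes "d = 2" "v \<in> V"
  shows "excess v \<le> (rdeg v + 2) / 12"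
proof -
  have "(\<Sum>x\<in>nbrs v. 1 / rdeg x) \<le> 1 / real d + (rdeg v - 1) / (real d + 1)"
    unfolding deg_def[of V E v] using min_degree_nbr_unique by (intro sum_inverse_deg_le) auto
  then show ?thesis unfolding excess_def using assms(1) by (simp add: field_simps)
qed

lemma excess_pair:
  assumes "nbrs u = {w, x}" "w \<noteq> x"
  shows "excess u = 1 / rdeg w + 1 / rdeg x - 2 * q"
  using assms by (simp add: excess_def deg_def)

text \<open>The product inequality for the neighbours \<open>w\<close> and \<open>x\<close> of
  \<open>u\<close> on the path \<open>x, u, w, v\<close>, whose ends may coincide. Since
  \<open>2 * q = 1 / 2\<close> cancels \<open>1 / rdeg u\<close>, the excess of \<open>w\<close> is
  just \<open>1 / rdeg v\<close>.\<close>

lemma path_of_degree_2_vertices: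
  assumes "d = 2" "nbrs u = {w, x}" "w \<noteq> x" "nbrs w = {u, v}" "u \<noteq> v"
  shows "3 * rdeg v < rdeg x + 2"
proof -
  have E: "E u w" "E u x" "E w v" using assms mem_nbrs by auto
  then have V: "x \<in> V" "v \<in> V" using edge_in by auto
  have deg: "rdeg u = 2" using assms(2,3) by (simp add: deg_def)
  have "(1 / rdeg u)\<^sup>2 < excess w * excess x"
    using E assms(3) by (intro excess_mult_gt)
  also have "excess w = 1 / rdeg v"
    using excess_pair[OF assms(4,5)] deg assms(1) by simp
  also have "1 / rdeg v * excess x \<le> 1 / rdeg v * ((rdeg x + 2) / 12)"
    using excess_le_if_eq_2[OF assms(1) V(1)] by (intro mult_left_mono) auto
  finally show ?thesis
    using deg rdeg_pos[OF V(2)] by (simp add: power2_eq_square field_simps)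
qed

lemma no_adjacent_min_degree_vertices_if_eq_2:
  assumes "d = 2" "E u w" "deg V E u = 2"
  shows "3 \<le> deg V E w"
proof (rule ccontr)
  assume "\<not> 3 \<le> deg V E w"
  moreover have "w \<in> V" using assms edge_in by blast
  ultimately have "deg V E w = 2" using deg_ge[of w] assms(1) by simp
  moreover have "w \<in> nbrs u" "u \<in> nbrs w"
    using assms(2) edge_sym by (auto simp: mem_nbrs)
  ultimately obtain x v where *: "nbrs u = {w, x}" "w \<noteq> x" "nbrs w = {u, v}" "u \<noteq> v"
    using assms(3) unfolding deg_def card_2_iff by (metis doubleton_eq_iff insertE singletonD)
  have "3 * rdeg v < rdeg x + 2"
    using path_of_degree_2_vertices[OF assms(1) *] .
  \<comment> \<open>The same path read backwards; adding both bounds forces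
    \<open>rdeg x + rdeg v < 2\<close>.\<close>
  moreover have "3 * rdeg x < rdeg v + 2"
    using path_of_degree_2_vertices[OF assms(1) *(3,4,1,2)] .
  moreover have "x \<in> V" "v \<in> V" using * by (auto simp: neighbours_def)
  then have "d \<le> deg V E x" "d \<le> deg V E v" using deg_ge by auto
  ultimately show False using assms(1) by linarith
qed

text \<open>Positive excess of \<open>u\<close> forces its neighbours to have small degrees, while
  the product inequality forces large ones.\<close>

lemma no_min_degree_vertex_if_eq_2:
  assumes "d = 2" "u \<in> V"
  shows "deg V E u \<noteq> 2"
proof
  assume u: "deg V E u = 2"
  then obtain w x where wx: "nbrs u = {w, x}" "w \<noteq> x"
    unfolding deg_def card_2_iff by blast
  then have E: "E u w" "E u x" using mem_nbrs by auto
  then have V: "w \<in> V" "x \<in> V" using edge_in by auto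
  define a b where "a = deg V E w" and "b = deg V E x"
  have ab: "3 \<le> a" "3 \<le> b"
    unfolding a_def b_def using no_adjacent_min_degree_vertices_if_eq_2 assms(1) E u by blast+
  have "1 / real a + 1 / real b > 1 / 2"
    using excess_pos[OF assms(2)] excess_pair[OF wx] assms(1) by (simp add: a_def b_def)
  then have "real (a * b) < real (2 * (a + b))"
    using ab by (simp add: field_simps)
  then have small: "a * b < 2 * (a + b)" by (simp only: of_nat_less_iff)
  have "(1 / rdeg u)\<^sup>2 < excess w * excess x"
    using E wx(2) by (intro excess_mult_gt)
  also have "\<dots> \<le> ((rdeg w + 2) / 12) * ((rdeg x + 2) / 12)"
    using excess_le_if_eq_2[OF assms(1)] excess_pos V by (intro mult_mono) (auto intro: less_imp_le)
  finally have "real 36 < real ((a + 2) * (b + 2))"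
    using u by (simp add: a_def b_def power2_eq_square algebra_simps)
  then have "36 < (a + 2) * (b + 2)" by (simp only: of_nat_less_iff)
  then have large: "32 < a * b + 2 * (a + b)" by (simp add: algebra_simps)
  \<comment> \<open>Shifted by 3, the first bound gives \<open>s * t + s + t \<le> 2\<close>, hence
    \<open>s * t + 5 * s + 5 * t \<le> 2 + 4 * 2 = 10\<close>, below the 12 that the second
    requires.\<close>
  obtain s t where st: "a = s + 3" "b = t + 3"
    using ab by (metis add.commute le_Suc_ex)
  have "s * t + s + t < 3" using small st by (simp add: algebra_simps)
  moreover have "11 < s * t + 5 * s + 5 * t" using large st by (simp add: algebra_simps)
  moreover have "s + t \<le> 2" using calculation(1) by linarith
  ultimately show False by linarith
qed

end

theorem mainTheorem4:
  fixes V :: "'a set" and E :: "'a \<Rightarrow> 'a \<Rightarrow> bool"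
  assumes "simple_graph V E"
    and "connected_graph V E"
    and "card V \<ge> 3"
    and "min_degree V E \<ge> 2"
  shows "spectral_eps V E \<le> sqrt (real (min_degree V E) - 1) / real (min_degree V E)"
proof (rule ccontr)
  define d where "d = min_degree V E"
  assume contra: "\<not> spectral_eps V E \<le> sqrt (real (min_degree V E) - 1) / real (min_degree V E)"
  have fin: "finite V" using assms(1) by (simp add: simple_graph_def)
  have ne: "V \<noteq> {}" using assms(3) by auto
  have d: "2 \<le> d" using assms(4) by (simp add: d_def)
  have deg_ge: "d \<le> deg V E v" if "v \<in> V" for v
    unfolding d_def min_degree_def using fin that by simp
  have "d \<in> deg V E ` V"
    unfolding d_def min_degree_def using fin ne by (intro Min_in) auto
  \<comment> \<open>The vertex of minimum degree that both final cases rule out.\<close>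
  then obtain u where u: "u \<in> V" "deg V E u = d" by blast
  interpret positive_degree_graph V E
    using assms(1) deg_ge d by unfold_locales force+
  obtain m where m: "0 \<le> m" "spectral_eps V E \<le> sqrt m" "\<And>f. m * inner_deg f f \<le> energy f f"
    using spectral_eps_rayleigh[OF ne] by blast
  have "sqrt ((real d - 1) / (real d)\<^sup>2) = sqrt (real d - 1) / real d"
    by (simp add: real_sqrt_divide)
  then have "sqrt ((real d - 1) / (real d)\<^sup>2) < sqrt m"
    using contra m(2) by (simp add: d_def)
  then have q: "(real d - 1) / (real d)\<^sup>2 < m"
    by (simp only: real_sqrt_less_iff)
  \<comment> \<open>The negated bound gives \<open>m > q\<close>, which makes the Rayleigh
    inequality strict for every \<open>f\<close> that is nonzero on \<open>V\<close>.\<close>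
  interpret extremal_gap_graph V E d
  proof unfold_locales
    fix f :: "'a \<Rightarrow> real" assume "\<exists>v\<in>V. f v \<noteq> 0"
    then have "0 < inner_deg f f" using inner_deg_pos by blast
    then have "(real d - 1) / (real d)\<^sup>2 * inner_deg f f < m * inner_deg f f"
      using q by (intro mult_strict_right_mono)
    then show "(real d - 1) / (real d)\<^sup>2 * inner_deg f f < energy f f"
      using m(3)[of f] by linarith
  qed (use d deg_ge in auto)
  show False
  proof (cases "d = 2")
    case True
    then show False using no_min_degree_vertex_if_eq_2[OF True u(1)] u(2) by simp
  next
    case False
    then show False using no_min_degree_vertex_if_ge_3[OF _ u(1)] u(2) d by simp
  qed
qed

end
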